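(* Let $n,m$ be positive integers, let $x_1,\dots,x_n$ be distinct real points, $u$ a marked point on the real line distinct from them, and let $\xi_1,\dots,\xi_m\in\mathbb{C}$ be a collection of points closed under complex conjugation and distinct from $u$ and all $x_j$. Consider the multiple chordal Loewner flow with parametrization $(\nu_1(t),\dots,\nu_n(t))$ started from this data. Then for each $z\in\overline{\mathbb{H}}$, $$N_t(z)=(g_t(z)-u(t))^{2m-n-2}\,g_t'(z)\,\frac{\prod_{k=1}^{n}(g_t(z)-x_k(t))}{\prod_{j=1}^{m}(g_t(z)-\xi_j(t))^2}$$ is an integral of motion on the interval $[0,\tau_z\wedge\tau)$, i.e. $N_t(z)=N_0(z)$ for all $t\in[0,\tau_z\wedge\tau)$ (as an element of $\widehat{\mathbb{C}}$). If instead $u=\infty$, the same holds, for the flow with marked point $\infty$, for $$N_t(z)=g_t'(z)\,\frac{\prod_{k=1}^{n}(g_t(z)-x_k(t))}{\prod_{j=1}^{m}(g_t(z)-\xi_j(t))^2}.$$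
   Context: Let $\nu_j:[0,\infty)\to[0,\infty)$, $j=1,\dots,n$, be measurable. The multiple chordal Loewner flow with parametrization $\boldsymbol{\nu}$ is given by $$\partial_t g_t(z)=\sum_{j=1}^n\frac{2\nu_j(t)}{g_t(z)-x_j(t)},\qquad g_0(z)=z,$$ where $x_j(0)=x_j$ and, for $u$ finite, $$\dot x_j=\nu_j(t)\Big(\sum_{k\neq j}\frac{2}{x_j-x_k}-\sum_{l=1}^m\frac{4}{x_j-\xi_l}+\frac{4m-2n-4}{x_j-u}\Big)+\sum_{k\neq j}\frac{2\nu_k(t)}{x_j-x_k},$$ while for $u=\infty$ the term with $u$ is omitted. The other marked points follow the flow: $\xi_l(t)=g_t(\xi_l)$ and $u(t)=g_t(u)$, i.e. $\dot\xi_l=\sum_j\frac{2\nu_j}{\xi_l-x_j}$ and $\dot u=\sum_j\frac{2\nu_j}{u-x_j}$ (with $g_t$ extended to the lower half-plane by reflection). The points $\xi$ are not required to solve any stationary relations. Here $\tau$ is the lifetime of the flow: the first time at which two of the $x_j(t)$ collide, or some $x_j(t)$ collides with $u(t)$ or some $\xi_l(t)$. For $z\in\overline{\mathbb{H}}$, $\tau_z$ is the first time at which $g_t(z)=x_j(t)$ for some $j$. *)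

theory Defs
  imports "HOL-Analysis.Analysis" "HOL-Library.Multiset" "HOL-Library.Extended_Real"
begin

datatype riemann_sphere = Finite complex | Infinity

text \<open>
  Conventions. The driving points are \<open>x j t\<close> for \<open>j \<in> {1..n}\<close>, with initial positions
  \<open>x0 j\<close>; the initial positions of the other finite marked points are \<open>\<xi>0 l\<close>, \<open>l \<in> {1..m}\<close>.
  The marked point \<open>u0\<close> is \<open>Some r\<close> for a real number \<open>r\<close> and \<open>None\<close> for infinity.
  The evolution of the marked points is \<open>\<xi>\<^sub>l(t) = g t (\<xi>0 l)\<close> and \<open>u(t) = g t r\<close>.
\<close>

definition collision ::
  "nat \<Rightarrow> nat \<Rightarrow> (nat \<Rightarrow> complex) \<Rightarrow> real option \<Rightarrow> (nat \<Rightarrow> real \<Rightarrow> real) \<Rightarrow> (real \<Rightarrow> complex \<Rightarrow> complex)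
    \<Rightarrow> real \<Rightarrow> bool" where
  "collision n m \<xi>0 u0 x g t \<longleftrightarrow>
     (\<exists>j\<in>{1..n}. \<exists>k\<in>{1..n}. j \<noteq> k \<and> x j t = x k t) \<or>
     (\<exists>j\<in>{1..n}. \<exists>l\<in>{1..m}. complex_of_real (x j t) = g t (\<xi>0 l)) \<or>
     (\<exists>r. u0 = Some r \<and> (\<exists>j\<in>{1..n}. complex_of_real (x j t) = g t (complex_of_real r)))"

definition lifetime ::
  "nat \<Rightarrow> nat \<Rightarrow> (nat \<Rightarrow> complex) \<Rightarrow> real option \<Rightarrow> (nat \<Rightarrow> real \<Rightarrow> real) \<Rightarrow> (real \<Rightarrow> complex \<Rightarrow> complex)
    \<Rightarrow> ereal" where
  "lifetime n m \<xi>0 u0 x g = Inf {ereal t | t. 0 \<le> t \<and> collision n m \<xi>0 u0 x g t}"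

definition swallowing_time ::
  "nat \<Rightarrow> (nat \<Rightarrow> real \<Rightarrow> real) \<Rightarrow> (real \<Rightarrow> complex \<Rightarrow> complex) \<Rightarrow> complex \<Rightarrow> ereal" where
  "swallowing_time n x g z =
     Inf {ereal t | t. 0 \<le> t \<and> (\<exists>j\<in>{1..n}. g t z = complex_of_real (x j t))}"

definition loewner_field ::
  "nat \<Rightarrow> (nat \<Rightarrow> real \<Rightarrow> real) \<Rightarrow> (nat \<Rightarrow> real \<Rightarrow> real) \<Rightarrow> (real \<Rightarrow> complex \<Rightarrow> complex)
    \<Rightarrow> complex \<Rightarrow> real \<Rightarrow> complex" where
  "loewner_field n \<nu> x g z s =
     (\<Sum>j=1..n. 2 * complex_of_real (\<nu> j s) / (g s z - complex_of_real (x j s)))"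

definition driving_field ::
  "nat \<Rightarrow> nat \<Rightarrow> (nat \<Rightarrow> real \<Rightarrow> real) \<Rightarrow> (nat \<Rightarrow> complex) \<Rightarrow> real option
    \<Rightarrow> (nat \<Rightarrow> real \<Rightarrow> real) \<Rightarrow> (real \<Rightarrow> complex \<Rightarrow> complex) \<Rightarrow> nat \<Rightarrow> real \<Rightarrow> complex" where
  "driving_field n m \<nu> \<xi>0 u0 x g j s =
     complex_of_real (\<nu> j s) *
       ((\<Sum>k\<in>{1..n}-{j}. 2 / (complex_of_real (x j s) - complex_of_real (x k s)))
        - (\<Sum>l=1..m. 4 / (complex_of_real (x j s) - g s (\<xi>0 l)))
        + (case u0 of
             None \<Rightarrow> 0
           | Some r \<Rightarrow> (4 * of_nat m - 2 * of_nat n - 4)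
                        / (complex_of_real (x j s) - g s (complex_of_real r))))
     + (\<Sum>k\<in>{1..n}-{j}. 2 * complex_of_real (\<nu> k s)
                          / (complex_of_real (x j s) - complex_of_real (x k s)))"

text \<open>
  Since \<open>\<nu>\<close> is only measurable, the differential equations are understood in the sense of
  Caratheodory, as integral equations. Integrability of \<open>\<nu>\<close> up to times before the lifetime
  is part of this notion of solution (the total half-plane capacity is finite).

  Values of \<open>x\<close> from the lifetime onwards are not constrained, nor (except for the reflection
  symmetry) are values of \<open>t \<mapsto> g t z\<close> after the swallowing time of \<open>z\<close>. The last clause says
  that the swallowing time, if it precedes the lifetime, is a true first hitting time of
  a trajectory that is continuous up to and including that time; otherwise the arbitrary values
  of \<open>g\<close> beyond the solution interval could make the infimum spuriously small.
\<close>

definition multiple_chordal_loewner_flow ::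
  "nat \<Rightarrow> nat \<Rightarrow> (nat \<Rightarrow> real \<Rightarrow> real) \<Rightarrow> (nat \<Rightarrow> real) \<Rightarrow> (nat \<Rightarrow> complex) \<Rightarrow> real option
    \<Rightarrow> (nat \<Rightarrow> real \<Rightarrow> real) \<Rightarrow> (real \<Rightarrow> complex \<Rightarrow> complex) \<Rightarrow> bool" where
  "multiple_chordal_loewner_flow n m \<nu> x0 \<xi>0 u0 x g \<longleftrightarrow>
     (let \<tau> = lifetime n m \<xi>0 u0 x g; \<tau>\<^sub>z = swallowing_time n x g in
       (\<forall>j\<in>{1..n}. \<forall>t. 0 \<le> t \<and> ereal t < \<tau> \<longrightarrow> \<nu> j absolutely_integrable_on {0..t}) \<and>
       (\<forall>j\<in>{1..n}. x j 0 = x0 j) \<and>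
       (\<forall>z. g 0 z = z) \<and>
       (\<forall>t z. 0 \<le> t \<and> ereal t < \<tau> \<longrightarrow> g t (cnj z) = cnj (g t z)) \<and>
       (\<forall>j\<in>{1..n}. \<forall>t. 0 \<le> t \<and> ereal t < \<tau> \<longrightarrow>
          (driving_field n m \<nu> \<xi>0 u0 x g j has_integral
             complex_of_real (x j t) - complex_of_real (x0 j)) {0..t}) \<and>
       (\<forall>z t. 0 \<le> Im z \<and> 0 \<le> t \<and> ereal t < min (\<tau>\<^sub>z z) \<tau> \<longrightarrow>
          (loewner_field n \<nu> x g z has_integral g t z - z) {0..t}) \<and>
       (\<forall>z t. 0 \<le> Im z \<and> 0 \<le> t \<and> ereal t = \<tau>\<^sub>z z \<and> ereal t < \<tau> \<longrightarrow>
          (\<exists>j\<in>{1..n}. g t z = complex_of_real (x j t)) \<and>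
          continuous_on {0..t} (\<lambda>s. g s z)))"

text \<open>
  The integrals of motion take values in the sphere: the value is infinity at a zero of the
  denominator. For the finite marked point, a zero of \<open>g\<^sub>t(z) - u(t)\<close> is a pole exactly when
  the exponent \<open>2m - n - 2\<close> is negative.
  The derivative \<open>g\<^sub>t'\<close> is the complex one also on the real line, \<open>g\<^sub>t\<close> being extended by
  reflection.
\<close>

definition motion_integral_finite ::
  "nat \<Rightarrow> nat \<Rightarrow> (nat \<Rightarrow> complex) \<Rightarrow> real \<Rightarrow> (nat \<Rightarrow> real \<Rightarrow> real) \<Rightarrow> (real \<Rightarrow> complex \<Rightarrow> complex)
    \<Rightarrow> real \<Rightarrow> complex \<Rightarrow> riemann_sphere" where
  "motion_integral_finite n m \<xi>0 r x g t z =
     (let u\<^sub>t = g t (complex_of_real r); e = 2 * int m - int n - 2 in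
      if (\<exists>l\<in>{1..m}. g t z = g t (\<xi>0 l)) \<or> (g t z = u\<^sub>t \<and> e < 0) then Infinity
      else Finite ((g t z - u\<^sub>t) powi e * deriv (g t) z
             * (\<Prod>k=1..n. g t z - complex_of_real (x k t))
             / (\<Prod>l=1..m. (g t z - g t (\<xi>0 l))\<^sup>2)))"

definition motion_integral_infinity ::
  "nat \<Rightarrow> nat \<Rightarrow> (nat \<Rightarrow> complex) \<Rightarrow> (nat \<Rightarrow> real \<Rightarrow> real) \<Rightarrow> (real \<Rightarrow> complex \<Rightarrow> complex)
    \<Rightarrow> real \<Rightarrow> complex \<Rightarrow> riemann_sphere" where
  "motion_integral_infinity n m \<xi>0 x g t z =
     (if \<exists>l\<in>{1..m}. g t z = g t (\<xi>0 l) then Infinity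
      else Finite (deriv (g t) z
             * (\<Prod>k=1..n. g t z - complex_of_real (x k t))
             / (\<Prod>l=1..m. (g t z - g t (\<xi>0 l))\<^sup>2)))"

end

theory Submission
  imports Defs
begin

text \<open>
  Every factor of \<open>N\<^sub>t(z)\<close> solves a linear equation \<open>f' = f a\<close>, in integrated form, with an
  integrable rate \<open>a\<close>, so it equals its initial value times \<open>exp (integral {0..t} a)\<close>. For the
  difference of two trajectories \<open>z\<close> and \<open>w\<close> the rate is
  \<open>-\<Sum>\<^sub>j 2\<nu>\<^sub>j / ((g(z) - x\<^sub>j) (g(w) - x\<^sub>j))\<close>; letting \<open>w\<close> tend to \<open>z\<close> gives the same formula with
  \<open>w = z\<close> as rate of \<open>g'\<close>. The limit requires that all points near \<open>z\<close> survive as long as \<open>z\<close>,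
  which follows from the exponential formula by a first exit argument. The driving terms are chosen
  such that the rates, weighted by the exponents of the factors, add up to zero at each time.
  Zeros and poles of \<open>N\<^sub>0\<close> are preserved since distinct trajectories never meet.
\<close>

section \<open>Linear integral equations with an integrable coefficient\<close>

lemma absolutely_integrable_continuous_times:
  fixes f :: "real \<Rightarrow> 'a::{euclidean_space,real_normed_algebra}"
  assumes "continuous_on {a..b} f" "g absolutely_integrable_on {a..b}"
  shows "(\<lambda>s. f s * g s) absolutely_integrable_on {a..b}"
proof (rule absolutely_integrable_bounded_measurable_product[OF bilinear_times])
  show "f \<in> borel_measurable (lebesgue_on {a..b})"
    using assms by (intro continuous_imp_measurable_on_sets_lebesgue) auto
  show "bounded (f ` {a..b})"
    using assms by (simp add: compact_continuous_image compact_imp_bounded)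
qed (use assms in auto)

lemma absolutely_integrable_of_real:
  assumes "f absolutely_integrable_on S"
  shows "(\<lambda>s. complex_of_real (f s)) absolutely_integrable_on S"
  using absolutely_integrable_linear[OF assms bounded_linear_of_real] by (simp add: o_def)

text \<open>Adding up increments along a fine partition gives
  \<open>norm (h b - h a) \<le> e * (V b - V a)\<close> for every positive \<open>e\<close>. The
  control function \<open>V\<close> takes the place of length in the classical argument for
  functions with zero derivative, which would need a derivative at every point.\<close>

lemma constant_if_increments_small:
  fixes h :: "real \<Rightarrow> 'a::real_normed_vector" and V :: "real \<Rightarrow> real"
  assumes "a \<le> b"
    and small: "\<And>e. 0 < e \<Longrightarrow> \<exists>d>0. \<forall>p q. a \<le> p \<and> p \<le> q \<and> q \<le> b \<and> q - p < d
                  \<longrightarrow> norm (h q - h p) \<le> e * (V q - V p)"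
  shows "h b = h a"
proof -
  have bound: "norm (h b - h a) \<le> e * (V b - V a)" if "0 < e" for e
  proof -
    obtain d where "d > 0" and d: "\<And>p q. a \<le> p \<Longrightarrow> p \<le> q \<Longrightarrow> q \<le> b \<Longrightarrow> q - p < d
                  \<Longrightarrow> norm (h q - h p) \<le> e * (V q - V p)"
      using small[OF \<open>0 < e\<close>] by blast
    \<comment> \<open>Bolzano's principle does the partitioning. It also tests small intervals that
      stick out of \<open>{a..b}\<close>; the guards \<open>a \<le> p\<close> and
      \<open>q \<le> b\<close> make the property vacuous there.\<close>
    have "a \<le> a \<longrightarrow> b \<le> b \<longrightarrow> norm (h b - h a) \<le> e * (V b - V a)"
      using \<open>a \<le> b\<close>
    proof (rule Bolzano[where P = "\<lambda>p q. a \<le> p \<longrightarrow> q \<le> b \<longrightarrow> norm (h q - h p) \<le> e * (V q - V p)"])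
      fix p q r :: real
      assume *: "a \<le> p \<longrightarrow> q \<le> b \<longrightarrow> norm (h q - h p) \<le> e * (V q - V p)"
        "a \<le> q \<longrightarrow> r \<le> b \<longrightarrow> norm (h r - h q) \<le> e * (V r - V q)" "p \<le> q" "q \<le> r"
      have "norm (h r - h p) \<le> norm (h r - h q) + norm (h q - h p)"
        using norm_triangle_ineq[of "h r - h q" "h q - h p"] by simp
      then show "a \<le> p \<longrightarrow> r \<le> b \<longrightarrow> norm (h r - h p) \<le> e * (V r - V p)"
        using * by (auto simp: algebra_simps)
    next
      fix y assume "a \<le> y" "y \<le> b"
      show "\<exists>d>0. \<forall>p q. p \<le> y \<and> y \<le> q \<and> q - p < d \<longrightarrow>
          a \<le> p \<longrightarrow> q \<le> b \<longrightarrow> norm (h q - h p) \<le> e * (V q - V p)"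
        using d \<open>d > 0\<close> by (meson order_trans)
    qed
    then show ?thesis by simp
  qed
  have "norm (h b - h a) \<le> 0"
  proof (rule field_le_epsilon)
    fix e :: real assume "e > 0"
    \<comment> \<open>The summand 1 avoids a division by zero when \<open>V b = V a\<close>.\<close>
    define e' where "e' = e / (1 + \<bar>V b - V a\<bar>)"
    have "e' > 0" using \<open>e > 0\<close> by (simp add: e'_def)
    have "norm (h b - h a) \<le> e' * \<bar>V b - V a\<bar>"
      using bound[OF \<open>e' > 0\<close>] \<open>e' > 0\<close> by (smt (verit) mult_left_mono)
    also have "\<dots> \<le> e" using \<open>e > 0\<close> by (simp add: e'_def field_simps)
    finally show "norm (h b - h a) \<le> 0 + e" by simp
  qed
  then show ?thesis by simp
qed

text \<open>
  The coefficient is merely integrable, so no pointwise product rule is available for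
  \<open>h s = f s * exp (- integral {0..s} a)\<close>; instead the increments of \<open>h\<close> are small compared with
  those of \<open>integral {0..s} (norm a)\<close>.
\<close>

lemma linear_integral_equation_exp:
  fixes f a :: "real \<Rightarrow> complex"
  assumes "0 \<le> T"
    and a: "a absolutely_integrable_on {0..T}"
    and f: "\<And>t. 0 \<le> t \<Longrightarrow> t \<le> T \<Longrightarrow> ((\<lambda>s. f s * a s) has_integral f t - f 0) {0..t}"
  shows "f T = f 0 * exp (integral {0..T} a)"
proof -
  define A where "A s = integral {0..s} a" for s
  define V where "V s = integral {0..s} (\<lambda>s. norm (a s))" for s
  have ai: "a integrable_on {0..T}" and ni: "(\<lambda>s. norm (a s)) integrable_on {0..T}"
    using a by (auto simp: absolutely_integrable_on_def)
  have fi: "(\<lambda>s. f s * a s) integrable_on {0..T}"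
    using f[of T] \<open>0 \<le> T\<close> by auto
  have contA: "continuous_on {0..T} A" and contV: "continuous_on {0..T} V"
    unfolding A_def V_def by (auto intro!: indefinite_integral_continuous_1 ai ni)
  have f_eq: "f t = f 0 + integral {0..t} (\<lambda>s. f s * a s)" if "t \<in> {0..T}" for t
    using integral_unique[OF f[of t]] that by auto
  have contf: "continuous_on {0..T} f"
    by (subst continuous_on_cong[OF refl f_eq]) (auto intro!: continuous_intros indefinite_integral_continuous_1 fi)
  have inc: "integral {0..q} k - integral {0..p} k = integral {p..q} k"
    if "k integrable_on {0..T}" "0 \<le> p" "p \<le> q" "q \<le> T" for k :: "real \<Rightarrow> 'b::banach" and p q
    using Henstock_Kurzweil_Integration.integral_combine[of 0 p q k] that integrable_subinterval_real[OF that(1), of 0 q]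
    by (auto simp: algebra_simps)
  have bounded_cont: "\<exists>C>0. \<forall>s\<in>{0..T}. norm (k s) \<le> C" if "continuous_on {0..T} k" for k :: "real \<Rightarrow> complex"
    using compact_imp_bounded[OF compact_continuous_image[OF that compact_Icc]]
    by (auto simp: bounded_pos)
  define h where "h s = f s * exp (- A s)" for s
  have "h T = h 0"
  proof (rule constant_if_increments_small[OF \<open>0 \<le> T\<close>, where V = V])
    fix e :: real assume "0 < e"
    obtain C1 where "C1 > 0" and C1: "\<And>s. s \<in> {0..T} \<Longrightarrow> norm (f s) \<le> C1"
      using bounded_cont[OF contf] by blast
    obtain C2 where "C2 > 0" and C2: "\<And>s. s \<in> {0..T} \<Longrightarrow> norm (exp (- A s)) \<le> C2"
      using bounded_cont[OF continuous_on_exp[OF continuous_on_minus[OF contA]]] by blast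
    \<comment> \<open>Half of \<open>e\<close> is spent on the error of linearizing the exponential,
      which carries the factor \<open>C1 * C2\<close>, and a quarter on each of two errors from the
      oscillation of \<open>f\<close>, which carry only \<open>C2\<close>.\<close>
    define e1 where "e1 = e / (2 * C1 * C2)"
    define e2 where "e2 = e / (4 * C2)"
    have "e1 > 0" "e2 > 0" using \<open>0 < e\<close> \<open>C1 > 0\<close> \<open>C2 > 0\<close> by (auto simp: e1_def e2_def)
    have "(exp has_derivative (\<lambda>w. w)) (at (0::complex))"
      by (rule has_derivative_eq_rhs[OF DERIV_exp[of 0, unfolded has_field_derivative_def]])
        (simp add: fun_eq_iff)
    then obtain d1 where "d1 > 0" and d1: "\<And>w::complex. norm w < d1 \<Longrightarrow> norm (exp w - 1 - w) \<le> e1 * norm w"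
      using \<open>e1 > 0\<close> unfolding has_derivative_at_alt by fastforce
    obtain d2 where "d2 > 0" and d2: "\<And>s t. s \<in> {0..T} \<Longrightarrow> t \<in> {0..T} \<Longrightarrow> dist t s < d2 \<Longrightarrow> dist (A t) (A s) < d1"
      using compact_uniformly_continuous[OF contA compact_Icc] \<open>d1 > 0\<close>
      unfolding uniformly_continuous_on_def by metis
    obtain d3 where "d3 > 0" and d3: "\<And>s t. s \<in> {0..T} \<Longrightarrow> t \<in> {0..T} \<Longrightarrow> dist t s < d3 \<Longrightarrow> dist (f t) (f s) < e2"
      using compact_uniformly_continuous[OF contf compact_Icc] \<open>e2 > 0\<close>
      unfolding uniformly_continuous_on_def by metis
    show "\<exists>d>0. \<forall>p q. 0 \<le> p \<and> p \<le> q \<and> q \<le> T \<and> q - p < d \<longrightarrow> norm (h q - h p) \<le> e * (V q - V p)"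
    proof (intro exI conjI allI impI)
      show "min d2 d3 > 0" using \<open>d2 > 0\<close> \<open>d3 > 0\<close> by simp
    next
      fix p q assume "0 \<le> p \<and> p \<le> q \<and> q \<le> T \<and> q - p < min d2 d3"
      then have pq: "0 \<le> p" "p \<le> q" "q \<le> T" "q - p < d2" "q - p < d3" by auto
      have sub: "{p..q} \<subseteq> {0..T}" using pq by auto
      define D where "D = A q - A p"
      define v where "v = V q - V p"
      have Dint: "D = integral {p..q} a" unfolding D_def A_def using inc[OF ai] pq by simp
      have vint: "v = integral {p..q} (\<lambda>s. norm (a s))" unfolding v_def V_def using inc[OF ni] pq by simp
      have ai': "a integrable_on {p..q}" and ni': "(\<lambda>s. norm (a s)) integrable_on {p..q}"
        and fi': "(\<lambda>s. f s * a s) integrable_on {p..q}"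
        using sub ai ni fi by (auto intro: integrable_subinterval_real)
      have Dv: "norm D \<le> v"
        unfolding Dint vint by (rule integral_norm_bound_integral[OF ai' ni']) auto
      \<comment> \<open>\<open>f\<close> is frozen at the left end \<open>p\<close>; uniform
        continuity bounds the resulting error by \<open>e2 * v\<close>.\<close>
      have "f q - f p = integral {p..q} (\<lambda>s. f s * a s)"
        using f_eq[of p] f_eq[of q] inc[OF fi, of p q] pq by simp
      then have "f q - f p - f p * D = integral {p..q} (\<lambda>s. f s * a s - f p * a s)"
        unfolding Dint using ai' fi' by (subst integral_diff) (auto intro: integrable_on_mult_right)
      also have "norm \<dots> \<le> integral {p..q} (\<lambda>s. e2 * norm (a s))"
      proof (rule integral_norm_bound_integral)
        fix s assume s: "s \<in> {p..q}"
        have "norm (f s - f p) \<le> e2"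
          using d3[of p s] s pq by (auto simp: dist_norm)
        then show "norm (f s * a s - f p * a s) \<le> e2 * norm (a s)"
          by (simp add: norm_mult mult_right_mono flip: left_diff_distrib)
      qed (use ai' fi' ni' in \<open>auto intro!: integrable_diff integrable_on_mult_right\<close>)
      also have "\<dots> = e2 * v" by (simp add: vint)
      finally have part2: "norm (f q - f p - f p * D) \<le> e2 * v" .
      have "norm (- D) < d1" using d2[of p q] pq by (auto simp: D_def dist_norm norm_minus_commute)
      then have "norm (exp (- D) - 1 - (- D)) \<le> e1 * norm D" using d1[of "- D"] by simp
      also have "\<dots> \<le> e1 * v" using Dv \<open>e1 > 0\<close> by simp
      finally have "norm (exp (- D) - 1 + D) \<le> e1 * v" by simp
      then have part1: "norm ((exp (- D) - 1 + D) * f q) \<le> (e1 * v) * C1"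
        unfolding norm_mult by (intro mult_mono) (use C1[of q] pq in \<open>auto intro: order_trans[OF norm_ge_zero]\<close>)
      have "norm (f p - f q) \<le> e2" using d3[of p q] pq by (auto simp: dist_norm norm_minus_commute)
      then have part3: "norm (D * (f p - f q)) \<le> v * e2"
        unfolding norm_mult using Dv order_trans[OF norm_ge_zero Dv] by (intro mult_mono) auto
      have "exp (- A q) = exp (- A p) * exp (- D)" by (simp add: D_def flip: exp_add)
      \<comment> \<open>Three errors remain after the first order terms cancel: the exponential
        against its linearization, the integral equation with \<open>f\<close> frozen at
        \<open>p\<close>, and \<open>f q\<close> against \<open>f p\<close> in the linear
        term.\<close>
      then have "h q - h p = exp (- A p) *
          ((exp (- D) - 1 + D) * f q + (f q - f p - f p * D) + D * (f p - f q))"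
        by (simp add: h_def algebra_simps)
      also have "norm \<dots> \<le> C2 * (e1 * v * C1 + e2 * v + v * e2)"
        unfolding norm_mult[of "exp (- A p)"]
        using C2[of p] pq \<open>C2 > 0\<close>
        by (intro mult_mono norm_triangle_le add_mono part1 part2 part3) auto
      also have "\<dots> = e * v"
        using \<open>C1 > 0\<close> \<open>C2 > 0\<close> by (simp add: e1_def e2_def field_simps)
      finally show "norm (h q - h p) \<le> e * (V q - V p)" by (simp add: v_def)
    qed
  qed
  then show ?thesis by (simp add: h_def A_def exp_minus field_simps)
qed

section \<open>Trajectories of the Loewner equation and their differences\<close>

text \<open>The driving functions are arbitrary continuous ones at this stage; their own
  differential equation enters only when the rates are shown to cancel.\<close>

locale loewner_trajectories =
  fixes n :: nat and \<nu> x :: "nat \<Rightarrow> real \<Rightarrow> real" and g :: "real \<Rightarrow> complex \<Rightarrow> complex" and T :: real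
  assumes T_nonneg: "0 \<le> T"
    and \<nu>_integrable: "j \<in> {1..n} \<Longrightarrow> \<nu> j absolutely_integrable_on {0..T}"
    and x_cont: "j \<in> {1..n} \<Longrightarrow> continuous_on {0..T} (x j)"
    and g_0: "g 0 z = z"
begin

text \<open>Avoidance is demanded separately: since division by zero yields zero, the integral
  equation alone does not rule out a hit.\<close>

definition trajectory :: "real \<Rightarrow> complex \<Rightarrow> bool" where
  "trajectory S w \<longleftrightarrow>
     (\<forall>t\<in>{0..S}. (loewner_field n \<nu> x g w has_integral g t w - w) {0..t}) \<and>
     (\<forall>t\<in>{0..S}. \<forall>j\<in>{1..n}. g t w \<noteq> complex_of_real (x j t))"

text \<open>The divided difference of the Loewner vector field between the images of
  \<open>z\<close> and \<open>w\<close>. For \<open>w = z\<close> it becomes the spatial derivative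
  of the field, the logarithmic rate of \<open>g'\<close>.\<close>

definition pair_rate :: "complex \<Rightarrow> complex \<Rightarrow> real \<Rightarrow> complex" where
  "pair_rate z w s = - (\<Sum>j=1..n. 2 * complex_of_real (\<nu> j s)
      / ((g s z - complex_of_real (x j s)) * (g s w - complex_of_real (x j s))))"

text \<open>For nonnegative \<open>\<nu>\<close> this is half the half-plane capacity accumulated up
  to \<open>T\<close>. It controls the exponents in the estimates below.\<close>

definition capacity :: real where
  "capacity = integral {0..T} (\<lambda>s. \<Sum>j=1..n. \<bar>\<nu> j s\<bar>)"

lemma trajectory_mono: "trajectory S w \<Longrightarrow> S' \<le> S \<Longrightarrow> trajectory S' w"
  unfolding trajectory_def by auto

lemma trajectory_avoids:
  "trajectory S w \<Longrightarrow> t \<in> {0..S} \<Longrightarrow> j \<in> {1..n} \<Longrightarrow> g t w \<noteq> complex_of_real (x j t)"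
  unfolding trajectory_def by blast

lemma trajectory_continuous:
  assumes "trajectory S w"
  shows "continuous_on {0..S} (\<lambda>s. g s w)"
proof (cases "0 \<le> S")
  case True
  have int: "loewner_field n \<nu> x g w integrable_on {0..S}"
    using assms True unfolding trajectory_def by force
  have g_eq: "g t w = w + integral {0..t} (loewner_field n \<nu> x g w)" if "t \<in> {0..S}" for t
    using assms that integral_unique[of "loewner_field n \<nu> x g w" "g t w - w"]
    unfolding trajectory_def by (metis add_diff_cancel_left' add_diff_eq)
  show ?thesis
    by (subst continuous_on_cong[OF refl g_eq]) (auto intro!: continuous_intros indefinite_integral_continuous_1 int)
qed auto

lemma \<nu>_integrable_subinterval:
  assumes "S \<le> T" "j \<in> {1..n}"
  shows "\<nu> j absolutely_integrable_on {0..S}"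
  using absolutely_integrable_on_subinterval[OF \<nu>_integrable[OF assms(2)]] assms(1) by auto

lemma \<nu>_times_continuous_integrable:
  assumes "S \<le> T" "j \<in> {1..n}" "continuous_on {0..S} c"
  shows "(\<lambda>s. c s * complex_of_real (\<nu> j s)) absolutely_integrable_on {0..S}"
  using absolutely_integrable_continuous_times[OF assms(3)
      absolutely_integrable_of_real[OF \<nu>_integrable_subinterval[OF assms(1,2)]]] .

lemma x_continuous_complex:
  assumes "S \<le> T" "j \<in> {1..n}"
  shows "continuous_on {0..S} (\<lambda>s. complex_of_real (x j s))"
  using continuous_on_subset[OF x_cont[OF assms(2)]] assms(1) by (intro continuous_intros) auto

lemma pair_rate_integrable:
  assumes "S \<le> T" "trajectory S z" "trajectory S w"
  shows "pair_rate z w absolutely_integrable_on {0..S}"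
proof -
  have "(\<lambda>s. \<Sum>j=1..n. (- 2 / ((g s z - complex_of_real (x j s)) * (g s w - complex_of_real (x j s))))
      * complex_of_real (\<nu> j s)) absolutely_integrable_on {0..S}"
    using assms
    by (intro absolutely_integrable_sum \<nu>_times_continuous_integrable continuous_intros
          trajectory_continuous x_continuous_complex)
       (auto simp: trajectory_def)
  then show ?thesis by (simp add: pair_rate_def[abs_def] sum_negf)
qed

lemma capacity_integrable: "(\<lambda>s. \<Sum>j=1..n. \<bar>\<nu> j s\<bar>) integrable_on {0..T}"
  using \<nu>_integrable by (intro integrable_sum) (auto simp: absolutely_integrable_on_def)

lemma capacity_nonneg: "0 \<le> capacity"
  unfolding capacity_def using capacity_integrable by (intro integral_nonneg) (auto intro: sum_nonneg)

lemma norm_integral_le_capacity: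
  fixes f :: "real \<Rightarrow> complex"
  assumes "S \<le> T" "f integrable_on {0..S}" "0 \<le> C"
    and "\<And>s. s \<in> {0..S} \<Longrightarrow> norm (f s) \<le> C * (\<Sum>j=1..n. \<bar>\<nu> j s\<bar>)"
  shows "norm (integral {0..S} f) \<le> C * capacity"
proof -
  have sub: "(\<lambda>s. \<Sum>j=1..n. \<bar>\<nu> j s\<bar>) integrable_on {0..S}"
    using capacity_integrable assms(1) by (auto intro: integrable_subinterval_real)
  have "norm (integral {0..S} f) \<le> integral {0..S} (\<lambda>s. C * (\<Sum>j=1..n. \<bar>\<nu> j s\<bar>))"
    by (rule integral_norm_bound_integral) (use assms sub in \<open>auto intro: integrable_on_mult_right\<close>)
  also have "\<dots> = C * integral {0..S} (\<lambda>s. \<Sum>j=1..n. \<bar>\<nu> j s\<bar>)" by simp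
  also have "\<dots> \<le> C * capacity"
    unfolding capacity_def using assms(1,3) sub capacity_integrable
    by (intro mult_left_mono integral_subset_le) (auto intro: sum_nonneg)
  finally show ?thesis .
qed

text \<open>By \<open>1 / a - 1 / b = (b - a) / (a * b)\<close> in every summand, the difference of
  two solutions solves a linear equation. As the exponential has no zero, distinct trajectories
  never meet.\<close>

lemma trajectory_difference:
  assumes "0 \<le> S" "S \<le> T" and z: "trajectory S z" and w: "trajectory S w"
  shows "g S z - g S w = (z - w) * exp (integral {0..S} (pair_rate z w))"
proof -
  have "g S z - g S w = (g 0 z - g 0 w) * exp (integral {0..S} (pair_rate z w))"
  proof (rule linear_integral_equation_exp[OF \<open>0 \<le> S\<close> pair_rate_integrable[OF \<open>S \<le> T\<close> z w]])
    fix t assume "0 \<le> t" "t \<le> S"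
    then have "((\<lambda>s. loewner_field n \<nu> x g z s - loewner_field n \<nu> x g w s) has_integral
         ((g t z - z) - (g t w - w))) {0..t}"
      using z w unfolding trajectory_def by (intro has_integral_diff) auto
    moreover have "loewner_field n \<nu> x g z s - loewner_field n \<nu> x g w s
        = (g s z - g s w) * pair_rate z w s" if "s \<in> {0..t}" for s
      unfolding loewner_field_def pair_rate_def sum_subtractf[symmetric] sum_distrib_left sum_negf[symmetric]
    proof (rule sum.cong[OF refl])
      fix j assume "j \<in> {1..n}"
      then have "g s z - complex_of_real (x j s) \<noteq> 0" "g s w - complex_of_real (x j s) \<noteq> 0"
        using z w that \<open>t \<le> S\<close> unfolding trajectory_def by auto
      then show "2 * complex_of_real (\<nu> j s) / (g s z - complex_of_real (x j s))
          - 2 * complex_of_real (\<nu> j s) / (g s w - complex_of_real (x j s)) =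
          (g s z - g s w) * - (2 * complex_of_real (\<nu> j s)
             / ((g s z - complex_of_real (x j s)) * (g s w - complex_of_real (x j s))))"
        by (simp add: divide_simps) (simp add: algebra_simps)
    qed
    ultimately show "((\<lambda>s. (g s z - g s w) * pair_rate z w s) has_integral
        g t z - g t w - (g 0 z - g 0 w)) {0..t}"
      by (subst has_integral_cong[where g = "\<lambda>s. loewner_field n \<nu> x g z s - loewner_field n \<nu> x g w s"])
         (auto simp: g_0 algebra_simps)
  qed
  then show ?thesis by (simp add: g_0)
qed

text \<open>The two distances are kept apart because the first exit argument knows \<open>d\<close>
  for the reference point \<open>z\<close> but only \<open>d / 2\<close> for its neighbour
  \<open>w\<close>.\<close>

lemma trajectory_difference_bound:
  assumes "0 \<le> S" "S \<le> T" and z: "trajectory S z" and w: "trajectory S w" and "0 < d" "0 < d'"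
    and dz: "\<And>s j. s \<in> {0..S} \<Longrightarrow> j \<in> {1..n} \<Longrightarrow> d \<le> norm (g s z - complex_of_real (x j s))"
    and dw: "\<And>s j. s \<in> {0..S} \<Longrightarrow> j \<in> {1..n} \<Longrightarrow> d' \<le> norm (g s w - complex_of_real (x j s))"
  shows "norm (g S w - g S z) \<le> norm (w - z) * exp (2 / (d * d') * capacity)"
proof -
  have "norm (integral {0..S} (pair_rate z w)) \<le> 2 / (d * d') * capacity"
  proof (rule norm_integral_le_capacity[OF \<open>S \<le> T\<close>])
    show "pair_rate z w integrable_on {0..S}"
      using pair_rate_integrable[OF \<open>S \<le> T\<close> z w] by (auto simp: absolutely_integrable_on_def)
    show "0 \<le> 2 / (d * d')" using \<open>0 < d\<close> \<open>0 < d'\<close> by simp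
    fix s assume s: "s \<in> {0..S}"
    show "norm (pair_rate z w s) \<le> 2 / (d * d') * (\<Sum>j=1..n. \<bar>\<nu> j s\<bar>)"
      unfolding pair_rate_def norm_minus_cancel sum_distrib_left
    proof (rule sum_norm_le)
      fix j assume j: "j \<in> {1..n}"
      have "d * d' \<le> norm ((g s z - complex_of_real (x j s)) * (g s w - complex_of_real (x j s)))"
        unfolding norm_mult using dz[OF s j] dw[OF s j] \<open>0 < d\<close> \<open>0 < d'\<close> by (intro mult_mono) auto
      then have "2 * \<bar>\<nu> j s\<bar> / norm ((g s z - complex_of_real (x j s)) * (g s w - complex_of_real (x j s)))
          \<le> 2 * \<bar>\<nu> j s\<bar> / (d * d')"
        using \<open>0 < d\<close> \<open>0 < d'\<close> by (intro frac_le mult_pos_pos) auto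
      then show "norm (2 * complex_of_real (\<nu> j s) /
          ((g s z - complex_of_real (x j s)) * (g s w - complex_of_real (x j s)))) \<le> 2 / (d * d') * \<bar>\<nu> j s\<bar>"
        by (simp add: norm_divide norm_mult)
    qed
  qed
  then have "norm (exp (integral {0..S} (pair_rate z w))) \<le> exp (2 / (d * d') * capacity)"
    using complex_Re_le_cmod[of "integral {0..S} (pair_rate z w)"] by simp
  then show ?thesis
    using trajectory_difference[OF assms(1,2) z w]
    by (subst norm_minus_commute, subst norm_minus_commute[of w z]) (auto simp: norm_mult intro: mult_left_mono)
qed

text \<open>Compactness of \<open>{0..T}\<close>: each of finitely many continuous positive
  distances attains its minimum.\<close>

lemma trajectory_distance:
  assumes "trajectory T z"
  obtains d where "0 < d" "\<And>s j. s \<in> {0..T} \<Longrightarrow> j \<in> {1..n} \<Longrightarrow> d \<le> norm (g s z - complex_of_real (x j s))"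
proof -
  have "\<exists>d>0. \<forall>s\<in>{0..T}. d \<le> norm (g s z - complex_of_real (x j s))" if j: "j \<in> {1..n}" for j
  proof -
    have "continuous_on {0..T} (\<lambda>s. norm (g s z - complex_of_real (x j s)))"
      by (intro continuous_intros trajectory_continuous[OF assms] x_continuous_complex j) auto
    from continuous_attains_inf[OF compact_Icc _ this]
    obtain t where "t \<in> {0..T}" "\<forall>s\<in>{0..T}. norm (g t z - complex_of_real (x j t)) \<le> norm (g s z - complex_of_real (x j s))"
      using T_nonneg by auto
    moreover have "g t z \<noteq> complex_of_real (x j t)"
      using assms j \<open>t \<in> {0..T}\<close> unfolding trajectory_def by auto
    ultimately show ?thesis by (intro exI[of _ "norm (g t z - complex_of_real (x j t))"]) auto
  qed
  then obtain f where f: "\<And>j. j \<in> {1..n} \<Longrightarrow> 0 < f j \<and> (\<forall>s\<in>{0..T}. f j \<le> norm (g s z - complex_of_real (x j s)))"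
    by metis
  \<comment> \<open>The extra element 1 keeps the set nonempty if \<open>n = 0\<close>.\<close>
  define d where "d = Min (insert 1 (f ` {1..n}))"
  have "0 < d" unfolding d_def using f by (subst Min_gr_iff) auto
  moreover have "d \<le> f j" if "j \<in> {1..n}" for j unfolding d_def using that by (intro Min_le) auto
  ultimately show ?thesis using f by (meson that order_trans)
qed

end

section \<open>Survival of nearby points and the spatial derivative of the flow\<close>

text \<open>The second alternative describes a first hit at time \<open>S\<close>. Continuity up to
  \<open>S\<close> is what carries estimates from the times before \<open>S\<close> over to the hit
  itself. The dichotomy concerns the closed upper half-plane; reflection supplies the points
  below.\<close>

locale loewner_flow_segment = loewner_trajectories +
  assumes reflection: "t \<in> {0..T} \<Longrightarrow> g t (cnj z) = cnj (g t z)"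
    and trajectory_or_hit: "0 \<le> Im w \<Longrightarrow> trajectory T w \<or>
      (\<exists>S\<in>{0..T}. continuous_on {0..S} (\<lambda>s. g s w) \<and> (\<forall>s\<in>{0..<S}. trajectory s w) \<and>
         (\<exists>j\<in>{1..n}. g S w = complex_of_real (x j S)))"
begin

text \<open>The equation may be conjugated because the \<open>x j\<close> and \<open>\<nu> j\<close>
  are real.\<close>

lemma trajectory_cnj:
  assumes "S \<le> T" "trajectory S w"
  shows "trajectory S (cnj w)"
  unfolding trajectory_def
proof (intro conjI ballI)
  fix t assume t: "t \<in> {0..S}"
  have "(cnj \<circ> loewner_field n \<nu> x g w has_integral cnj (g t w - w)) {0..t}"
    using assms t unfolding trajectory_def has_integral_cnj by auto
  moreover have "loewner_field n \<nu> x g (cnj w) s = (cnj \<circ> loewner_field n \<nu> x g w) s" if "s \<in> {0..t}" for s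
    using that t \<open>S \<le> T\<close> by (simp add: loewner_field_def reflection)
  ultimately show "(loewner_field n \<nu> x g (cnj w) has_integral g t (cnj w) - cnj w) {0..t}"
    using t \<open>S \<le> T\<close> reflection[of t w]
    by (subst has_integral_cong[where g = "cnj \<circ> loewner_field n \<nu> x g w"]) auto
  show "g t (cnj w) \<noteq> complex_of_real (x j t)" if "j \<in> {1..n}" for j
    using assms that t reflection[of t w] complex_cnj_cancel_iff[of "g t w" "complex_of_real (x j t)"]
    unfolding trajectory_def by auto
qed

text \<open>First exit argument. Until the first time \<open>s1\<close> at which the images are
  \<open>d / 2\<close> apart, \<open>w\<close> keeps distance \<open>d / 2\<close> from the driving
  points, so the exponential bound keeps the images within \<open>d / 4\<close>. By continuity this
  persists at \<open>s1\<close>, a contradiction. Since \<open>w\<close> need be a trajectory only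
  strictly before \<open>S\<close>, a possible hitting time is covered as well.\<close>

lemma trajectory_stays_close:
  assumes "0 \<le> S" "S \<le> T" and z: "trajectory T z" and "0 < d"
    and dz: "\<And>s j. s \<in> {0..T} \<Longrightarrow> j \<in> {1..n} \<Longrightarrow> d \<le> norm (g s z - complex_of_real (x j s))"
    and cont: "continuous_on {0..S} (\<lambda>s. g s w)" and w: "\<And>s. s \<in> {0..<S} \<Longrightarrow> trajectory s w"
    and small: "norm (w - z) * exp (2 / (d * (d / 2)) * capacity) \<le> d / 4"
    and s: "s \<in> {0..S}"
  shows "norm (g s w - g s z) < d / 2"
proof (rule ccontr)
  assume contra: "\<not> ?thesis"
  define f where "f s = norm (g s w - g s z)" for s
  have contf: "continuous_on {0..S} f"
    unfolding f_def using trajectory_continuous[OF z] \<open>S \<le> T\<close>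
    by (intro continuous_intros cont) (auto elim: continuous_on_subset)
  define B where "B = {0..S} \<inter> f -` {d / 2..}"
  have "closed B" unfolding B_def
    using contf by (intro continuous_closed_preimage) auto
  then have "compact B" using bounded_subset[OF bounded_closed_interval, of B 0 S] by (auto simp: B_def compact_eq_bounded_closed)
  moreover have "B \<noteq> {}" using s contra by (auto simp: B_def f_def)
  ultimately obtain s1 where s1: "s1 \<in> B" "\<And>r. r \<in> B \<Longrightarrow> s1 \<le> r"
    using compact_attains_inf[of B] by blast
  have below: "f r \<le> d / 4" if "r \<in> {0..<s1}" for r
  proof -
    have r: "0 \<le> r" "r < s1" "s1 \<le> S" using that s1 by (auto simp: B_def)
    have "norm (g r w - g r z) \<le> norm (w - z) * exp (2 / (d * (d / 2)) * capacity)"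
    proof (rule trajectory_difference_bound)
      show "trajectory r z" using trajectory_mono[OF z] r \<open>S \<le> T\<close> by auto
      show "trajectory r w" using w[of r] r by auto
      fix q j assume q: "q \<in> {0..r}" and j: "j \<in> {1..n}"
      show d: "d \<le> norm (g q z - complex_of_real (x j q))"
        using dz[OF _ j, of q] q r \<open>S \<le> T\<close> by auto
      have "q \<notin> B" using s1(2)[of q] q r by force
      then have "norm (g q w - g q z) \<le> d / 2" using q r by (auto simp: B_def f_def)
      then show "d / 2 \<le> norm (g q w - complex_of_real (x j q))"
        using d norm_triangle_ineq[of "g q z - g q w" "g q w - complex_of_real (x j q)"]
        by (simp add: norm_minus_commute)
    qed (use r \<open>S \<le> T\<close> \<open>0 < d\<close> in auto)
    then show ?thesis using small by (simp add: f_def)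
  qed
  have "f s1 \<le> d / 4"
  \<comment> \<open>At time 0 there are no earlier times to pass to the limit from, so the initial
    distance is estimated directly.\<close>
  proof (cases "s1 = 0")
    case True
    have "norm (w - z) * 1 \<le> norm (w - z) * exp (2 / (d * (d / 2)) * capacity)"
      using capacity_nonneg \<open>0 < d\<close> by (intro mult_left_mono) auto
    then show ?thesis using True small by (simp add: f_def g_0)
  next
    case False
    then have "0 < s1" "s1 \<le> S" using s1 by (auto simp: B_def)
    then show ?thesis
      using continuous_le_on_closure[of "{0..<s1}" f s1 "d / 4"] below continuous_on_subset[OF contf, of "{0..s1}"]
      by auto
  qed
  then show False using s1(1) \<open>0 < d\<close> by (auto simp: B_def)
qed

text \<open>A neighbour that hit a driving point at time \<open>S\<close> would still be within
  \<open>d / 2\<close> of the image of \<open>z\<close>, which itself is at least \<open>d\<close>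
  away from that point.\<close>

lemma nearby_trajectories:
  assumes "0 \<le> Im z" and z: "trajectory T z"
  obtains d \<rho> where "0 < d" "0 < \<rho>"
    "\<And>w s j. w \<in> ball z \<rho> \<Longrightarrow> s \<in> {0..T} \<Longrightarrow> j \<in> {1..n} \<Longrightarrow> d \<le> norm (g s w - complex_of_real (x j s))"
    "\<And>w. w \<in> ball z \<rho> \<Longrightarrow> trajectory T w"
proof -
  obtain d where "0 < d" and d: "\<And>s j. s \<in> {0..T} \<Longrightarrow> j \<in> {1..n} \<Longrightarrow> d \<le> norm (g s z - complex_of_real (x j s))"
    using trajectory_distance[OF z] by blast
  \<comment> \<open>The largest radius for which the exponential bound stays within
    \<open>d / 4\<close>.\<close>
  define \<rho> where "\<rho> = d / 4 / exp (2 / (d * (d / 2)) * capacity)"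
  have upper: "trajectory T w \<and> (\<forall>s\<in>{0..T}. \<forall>j\<in>{1..n}. d / 2 \<le> norm (g s w - complex_of_real (x j s)))"
    if "0 \<le> Im w" "norm (w - z) < \<rho>" for w
  proof -
    have small: "norm (w - z) * exp (2 / (d * (d / 2)) * capacity) \<le> d / 4"
      using that(2) unfolding \<rho>_def by (simp add: pos_less_divide_eq less_imp_le)
    \<comment> \<open>A general end time \<open>S\<close> is kept because the estimate serves twice:
      at a supposed hitting time, and on all of \<open>{0..T}\<close> once survival is
      known.\<close>
    have far: "d / 2 < norm (g s w - complex_of_real (x j s))"
      if "0 \<le> S" "S \<le> T" "continuous_on {0..S} (\<lambda>s. g s w)" "\<And>s. s \<in> {0..<S} \<Longrightarrow> trajectory s w"
        "s \<in> {0..S}" "j \<in> {1..n}" for S s j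
      using trajectory_stays_close[OF that(1,2) z \<open>0 < d\<close> d that(3,4) small that(5)]
        d[OF _ that(6), of s] that(2,5)
        norm_triangle_ineq[of "g s z - g s w" "g s w - complex_of_real (x j s)"]
      by (simp add: norm_minus_commute)
    have "trajectory T w"
      using trajectory_or_hit[OF that(1)]
    proof (elim disjE bexE conjE)
      fix S j assume "S \<in> {0..T}" "continuous_on {0..S} (\<lambda>s. g s w)" "\<forall>s\<in>{0..<S}. trajectory s w"
        "j \<in> {1..n}" "g S w = complex_of_real (x j S)"
      then show ?thesis using far[of S S j] \<open>0 < d\<close> by simp
    qed
    moreover have "d / 2 \<le> norm (g s w - complex_of_real (x j s))" if "s \<in> {0..T}" "j \<in> {1..n}" for s j
      using far[OF T_nonneg order_refl trajectory_continuous[OF \<open>trajectory T w\<close>] _ that]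
        trajectory_mono[OF \<open>trajectory T w\<close>] by force
    ultimately show ?thesis by blast
  qed
  have both: "trajectory T w \<and> (\<forall>s\<in>{0..T}. \<forall>j\<in>{1..n}. d / 2 \<le> norm (g s w - complex_of_real (x j s)))"
    if "norm (w - z) < \<rho>" for w
  proof (cases "0 \<le> Im w")
    case False
    \<comment> \<open>For \<open>w\<close> below the real axis the conjugate is at least as close to
      \<open>z\<close>, as \<open>z\<close> lies in the closed upper half-plane. Distances to real
      points do not change under conjugation.\<close>
    have "norm (cnj w - z) \<le> norm (w - z)"
      using False \<open>0 \<le> Im z\<close> unfolding cmod_def
      by (intro real_sqrt_le_mono add_left_mono) (simp add: abs_le_square_iff[symmetric])
    then have c: "trajectory T (cnj w)" "\<And>s j. s \<in> {0..T} \<Longrightarrow> j \<in> {1..n} \<Longrightarrow> d / 2 \<le> norm (g s (cnj w) - complex_of_real (x j s))"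
      using upper[of "cnj w"] False that by auto
    have "norm (g s (cnj w) - complex_of_real (x j s)) = norm (g s w - complex_of_real (x j s))" if "s \<in> {0..T}" for s j
      using reflection[OF that, of w] complex_mod_cnj[of "g s w - complex_of_real (x j s)"] by simp
    then show ?thesis using c trajectory_cnj[OF order_refl c(1)] by auto
  qed (use upper that in auto)
  show ?thesis
    using \<open>0 < d\<close> both by (intro that[of "d / 2" \<rho>]) (auto simp: \<rho>_def dist_norm norm_minus_commute)
qed

text \<open>By \<open>trajectory_difference\<close> the difference quotient at a nearby
  \<open>w\<close> is exactly the exponential of the integral of \<open>pair_rate w z\<close>. It
  remains to let \<open>w\<close> tend to \<open>z\<close> inside the integral, which works because
  the rates are Lipschitz in \<open>w\<close>, with a bound that is integrable in time.\<close>

lemma flow_has_field_derivative: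
  assumes "0 \<le> Im z" and z: "trajectory T z"
  shows "(g T has_field_derivative exp (integral {0..T} (pair_rate z z))) (at z)"
proof -
  obtain d \<rho> where "0 < d" "0 < \<rho>" and d:
    "\<And>w s j. w \<in> ball z \<rho> \<Longrightarrow> s \<in> {0..T} \<Longrightarrow> j \<in> {1..n} \<Longrightarrow> d \<le> norm (g s w - complex_of_real (x j s))"
    and traj: "\<And>w. w \<in> ball z \<rho> \<Longrightarrow> trajectory T w"
    using nearby_trajectories[OF assms] by blast
  have zb: "z \<in> ball z \<rho>" using \<open>0 < \<rho>\<close> by simp
  define K where "K = exp (2 / (d * d) * capacity)"
  have "0 < K" by (simp add: K_def)
  have int: "pair_rate w z integrable_on {0..T}" if "w \<in> ball z \<rho>" for w
    using pair_rate_integrable[OF order_refl traj[OF that] z] by (auto simp: absolutely_integrable_on_def)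
  \<comment> \<open>\<open>K\<close> is the Lipschitz constant of \<open>g s\<close> seen from
    \<open>z\<close>; the difference of the two rates has three factors of size at least
    \<open>d\<close> in its denominator.\<close>
  define L where "L = 2 * K / d ^ 3"
  have close: "norm (integral {0..T} (pair_rate w z) - integral {0..T} (pair_rate z z))
      \<le> (L * capacity) * norm (w - z)" if w: "w \<in> ball z \<rho>" for w
  proof -
    have "norm (integral {0..T} (\<lambda>s. pair_rate w z s - pair_rate z z s)) \<le> (L * norm (w - z)) * capacity"
    proof (rule norm_integral_le_capacity)
      show "(\<lambda>s. pair_rate w z s - pair_rate z z s) integrable_on {0..T}"
        using int[OF w] int[OF zb] by (rule integrable_diff)
      show "0 \<le> L * norm (w - z)" using \<open>0 < d\<close> \<open>0 < K\<close> by (simp add: L_def)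
      fix s assume s: "s \<in> {0..T}"
      have gs: "norm (g s w - g s z) \<le> K * norm (w - z)"
        unfolding K_def using s d[OF zb] d[OF w] \<open>0 < d\<close>
        by (subst mult.commute, intro trajectory_difference_bound trajectory_mono[OF z] trajectory_mono[OF traj[OF w]])
          auto
      have "pair_rate w z s - pair_rate z z s = (\<Sum>j=1..n. 2 * complex_of_real (\<nu> j s) * (g s w - g s z)
          / ((g s z - complex_of_real (x j s))\<^sup>2 * (g s w - complex_of_real (x j s))))"
        unfolding pair_rate_def minus_diff_minus sum_subtractf[symmetric] sum_negf[symmetric]
      proof (rule sum.cong[OF refl])
        fix j assume j: "j \<in> {1..n}"
        have "g s z - complex_of_real (x j s) \<noteq> 0" "g s w - complex_of_real (x j s) \<noteq> 0"
          using d[OF zb s j] d[OF w s j] \<open>0 < d\<close> by auto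
        then show "- (2 * complex_of_real (\<nu> j s) / ((g s w - complex_of_real (x j s)) * (g s z - complex_of_real (x j s))) -
            2 * complex_of_real (\<nu> j s) / ((g s z - complex_of_real (x j s)) * (g s z - complex_of_real (x j s)))) =
           2 * complex_of_real (\<nu> j s) * (g s w - g s z) /
             ((g s z - complex_of_real (x j s))\<^sup>2 * (g s w - complex_of_real (x j s)))"
          by (simp add: divide_simps power2_eq_square) (simp add: algebra_simps)
      qed
      also have "norm \<dots> \<le> L * norm (w - z) * (\<Sum>j=1..n. \<bar>\<nu> j s\<bar>)"
        unfolding sum_distrib_left
      proof (rule sum_norm_le)
        fix j assume j: "j \<in> {1..n}"
        have "d ^ 3 = d\<^sup>2 * d" by (simp add: power2_eq_square power3_eq_cube)
        also have "\<dots> \<le> norm ((g s z - complex_of_real (x j s))\<^sup>2 * (g s w - complex_of_real (x j s)))"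
          unfolding norm_mult norm_power using d[OF zb s j] d[OF w s j] \<open>0 < d\<close>
          by (intro mult_mono power_mono) auto
        finally have "norm (2 * complex_of_real (\<nu> j s) * (g s w - g s z)) /
            norm ((g s z - complex_of_real (x j s))\<^sup>2 * (g s w - complex_of_real (x j s)))
          \<le> (2 * \<bar>\<nu> j s\<bar> * (K * norm (w - z))) / d ^ 3"
          using gs \<open>0 < d\<close> \<open>0 < K\<close> by (intro frac_le) (auto simp: norm_mult intro: mult_left_mono order_trans[OF _ gs])
        then show "norm (2 * complex_of_real (\<nu> j s) * (g s w - g s z) /
            ((g s z - complex_of_real (x j s))\<^sup>2 * (g s w - complex_of_real (x j s))))
          \<le> L * norm (w - z) * \<bar>\<nu> j s\<bar>"
          by (simp add: norm_divide L_def mult_ac)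
      qed
      finally show "norm (pair_rate w z s - pair_rate z z s) \<le> L * norm (w - z) * (\<Sum>j=1..n. \<bar>\<nu> j s\<bar>)" .
    qed simp
    then show ?thesis
      using integral_diff[OF int[OF w] int[OF zb]] by (simp add: mult_ac)
  qed
  have "((\<lambda>w. integral {0..T} (pair_rate w z) - integral {0..T} (pair_rate z z)) \<longlongrightarrow> 0) (at z)"
  proof (rule Lim_null_comparison)
    show "\<forall>\<^sub>F w in at z. norm (integral {0..T} (pair_rate w z) - integral {0..T} (pair_rate z z))
      \<le> (L * capacity) * norm (w - z)"
      using eventually_at_ball[OF \<open>0 < \<rho>\<close>] by eventually_elim (use close in auto)
    show "((\<lambda>w. (L * capacity) * norm (w - z)) \<longlongrightarrow> 0) (at z)"
      by (auto intro!: tendsto_eq_intros)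
  qed
  then have "((\<lambda>w. exp (integral {0..T} (pair_rate w z))) \<longlongrightarrow> exp (integral {0..T} (pair_rate z z))) (at z)"
    by (intro tendsto_exp) (simp add: LIM_zero_iff)
  moreover have "\<forall>\<^sub>F w in at z. (g T w - g T z) / (w - z) = exp (integral {0..T} (pair_rate w z))"
    using eventually_at_ball'[OF \<open>0 < \<rho>\<close>]
    by eventually_elim (use trajectory_difference[OF T_nonneg order_refl traj z] in auto)
  ultimately show ?thesis
    unfolding has_field_derivative_iff by (simp add: tendsto_cong)
qed

end

section \<open>Cancellation of the rates and conservation at a fixed end time\<close>

text \<open>Here \<open>y\<close> are the driving points, \<open>v\<close> their speeds,
  \<open>G\<close> the image of \<open>z\<close>, and \<open>R\<close> the contribution of the other
  marked points. Partial fractions turn each quotient into a diagonal term and two sums over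
  \<open>j\<close> different from \<open>k\<close>; in the double sum over all pairs these two agree
  after exchanging the indices.\<close>

lemma sum_repulsion_cancel:
  fixes y v R :: "'i \<Rightarrow> 'a::field" and G :: 'a
  assumes I: "finite I" and G: "\<And>k. k \<in> I \<Longrightarrow> G \<noteq> y k" and y: "inj_on y I"
  shows "(\<Sum>k\<in>I. ((\<Sum>j\<in>I. 2 * v j / (G - y j)) - (v k * ((\<Sum>j\<in>I-{k}. 2 / (y k - y j)) + R k)
            + (\<Sum>j\<in>I-{k}. 2 * v j / (y k - y j)))) / (G - y k))
       = (\<Sum>k\<in>I. 2 * v k / ((G - y k) * (G - y k))) - (\<Sum>k\<in>I. v k * R k / (G - y k))"
proof -
  have "((\<Sum>j\<in>I. 2 * v j / (G - y j)) - (v k * ((\<Sum>j\<in>I-{k}. 2 / (y k - y j)) + R k)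
            + (\<Sum>j\<in>I-{k}. 2 * v j / (y k - y j)))) / (G - y k)
      = 2 * v k / ((G - y k) * (G - y k)) - v k * R k / (G - y k)
        + (\<Sum>j\<in>I-{k}. 2 * v j / ((G - y j) * (y j - y k)))
        - (\<Sum>j\<in>I-{k}. 2 * v k / ((G - y k) * (y k - y j)))" (is "?L = ?R") if k: "k \<in> I" for k
  proof -
    have pair: "(2 * v j / (G - y j) - 2 * v j / (y k - y j)) / (G - y k) = 2 * v j / ((G - y j) * (y j - y k))"
      if "j \<in> I - {k}" for j
    proof -
      have "G - y j \<noteq> 0" "G - y k \<noteq> 0" "y j - y k \<noteq> 0" "y k - y j \<noteq> 0"
        using G k that y by (auto simp: inj_on_def)
      then show ?thesis by (simp add: divide_simps) (simp add: algebra_simps)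
    qed
    have "?L = (2 * v k / (G - y k) + (\<Sum>j\<in>I-{k}. 2 * v j / (G - y j))
        - (v k * ((\<Sum>j\<in>I-{k}. 2 / (y k - y j)) + R k) + (\<Sum>j\<in>I-{k}. 2 * v j / (y k - y j)))) / (G - y k)"
      using I k by (simp add: sum.remove)
    also have "\<dots> = 2 * v k / ((G - y k) * (G - y k)) - v k * R k / (G - y k)
        + (\<Sum>j\<in>I-{k}. (2 * v j / (G - y j) - 2 * v j / (y k - y j)) / (G - y k))
        - v k / (G - y k) * (\<Sum>j\<in>I-{k}. 2 / (y k - y j))"
      by (simp add: add_divide_distrib diff_divide_distrib sum_subtractf distrib_left
            sum_divide_distrib sum_distrib_left mult_ac)
    also have "\<dots> = ?R"
      using pair by (simp add: sum_distrib_left mult.commute)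
    finally show ?thesis .
  qed
  moreover have "(\<Sum>k\<in>I. \<Sum>j\<in>I-{k}. 2 * v j / ((G - y j) * (y j - y k)))
      = (\<Sum>k\<in>I. \<Sum>j\<in>I-{k}. 2 * v k / ((G - y k) * (y k - y j)))"
  proof -
    \<comment> \<open>Both spellings occur: interchanging the sums exchanges the sides of
      \<open>k \<noteq> j\<close>.\<close>
    have "I - {k} = {j \<in> I. k \<noteq> j}" "I - {k} = {j \<in> I. j \<noteq> k}" for k by auto
    then show ?thesis
      using sum.swap_restrict[OF I I, of "\<lambda>k j. 2 * v j / ((G - y j) * (y j - y k))" "\<lambda>k j. k \<noteq> j"] by simp
  qed
  ultimately show ?thesis by (simp add: sum.distrib sum_subtractf)
qed

context loewner_flow_segment
begin

text \<open>The logarithmic derivative of the difference between the image of \<open>z\<close> and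
  the \<open>k\<close>-th driving point.\<close>

definition gap_rate :: "nat \<Rightarrow> (nat \<Rightarrow> complex) \<Rightarrow> real option \<Rightarrow> nat \<Rightarrow> complex \<Rightarrow> real \<Rightarrow> complex" where
  "gap_rate m \<xi>0 u0 k z s =
     (loewner_field n \<nu> x g z s - driving_field n m \<nu> \<xi>0 u0 x g k s) / (g s z - complex_of_real (x k s))"

context
  fixes m :: nat and \<xi>0 :: "nat \<Rightarrow> complex" and u0 :: "real option"
  assumes \<xi>: "l \<in> {1..m} \<Longrightarrow> trajectory T (\<xi>0 l)"
    and u: "u0 = Some r \<Longrightarrow> trajectory T (complex_of_real r)"
    and x_inj: "s \<in> {0..T} \<Longrightarrow> inj_on (\<lambda>j. x j s) {1..n}"
    and driving: "j \<in> {1..n} \<Longrightarrow> t \<in> {0..T} \<Longrightarrow>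
      (driving_field n m \<nu> \<xi>0 u0 x g j has_integral complex_of_real (x j t) - complex_of_real (x j 0)) {0..t}"
begin

text \<open>No denominator vanishes on \<open>{0..T}\<close>, so the field is a sum of continuous
  functions times the integrable \<open>\<nu> j\<close>; \<open>c\<close> collects the coefficient
  of \<open>\<nu> k\<close>.\<close>

lemma driving_field_integrable:
  assumes k: "k \<in> {1..n}"
  shows "driving_field n m \<nu> \<xi>0 u0 x g k absolutely_integrable_on {0..T}"
proof -
  define c where "c s = (\<Sum>j\<in>{1..n}-{k}. 2 / (complex_of_real (x k s) - complex_of_real (x j s)))
        - (\<Sum>l=1..m. 4 / (complex_of_real (x k s) - g s (\<xi>0 l)))
        + (case u0 of None \<Rightarrow> 0 | Some r \<Rightarrow> (4 * of_nat m - 2 * of_nat n - 4)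
                        / (complex_of_real (x k s) - g s (complex_of_real r)))" for s
  have ne: "x k s \<noteq> x j s" if "s \<in> {0..T}" "j \<in> {1..n} - {k}" for s j
    using inj_onD[OF x_inj[OF that(1)], of k j] k that(2) by auto
  have ne\<xi>: "complex_of_real (x k s) \<noteq> g s (\<xi>0 l)" if "s \<in> {0..T}" "l \<in> {1..m}" for s l
    using trajectory_avoids[OF \<xi>[OF that(2)] that(1) k] by simp
  have contu: "continuous_on {0..T} (\<lambda>s. case u0 of None \<Rightarrow> 0 | Some r \<Rightarrow> (4 * of_nat m - 2 * of_nat n - 4)
                        / (complex_of_real (x k s) - g s (complex_of_real r)))"
  proof (cases u0)
    case (Some r)
    have "complex_of_real (x k s) \<noteq> g s (complex_of_real r)" if "s \<in> {0..T}" for s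
      using trajectory_avoids[OF u[OF Some] that k] by simp
    then show ?thesis
      using trajectory_continuous[OF u[OF Some]] x_continuous_complex[OF order_refl k]
      by (auto simp: Some intro!: continuous_intros)
  qed simp
  have "continuous_on {0..T} c"
    unfolding c_def using k ne ne\<xi>
    by (intro continuous_intros contu x_continuous_complex trajectory_continuous[OF \<xi>] ballI) auto
  moreover have "driving_field n m \<nu> \<xi>0 u0 x g k = (\<lambda>s. c s * complex_of_real (\<nu> k s)
      + (\<Sum>j\<in>{1..n}-{k}. 2 / (complex_of_real (x k s) - complex_of_real (x j s)) * complex_of_real (\<nu> j s)))"
    by (rule ext) (simp add: driving_field_def c_def mult.commute)
  ultimately show ?thesis
    using k ne
    by (simp only:) (intro set_integral_add absolutely_integrable_sum \<nu>_times_continuous_integrable[OF order_refl] continuous_intros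
         x_continuous_complex, auto)
qed

lemma gap_rate_integrable:
  assumes z: "trajectory T z" and k: "k \<in> {1..n}"
  shows "gap_rate m \<xi>0 u0 k z absolutely_integrable_on {0..T}"
proof -
  have z_ne: "g s z - complex_of_real (x j s) \<noteq> 0" if "s \<in> {0..T}" "j \<in> {1..n}" for s j
    using trajectory_avoids[OF z that] by simp
  have "(\<lambda>s. \<Sum>j=1..n. 2 / (g s z - complex_of_real (x j s)) * complex_of_real (\<nu> j s)) absolutely_integrable_on {0..T}"
    using z_ne
    by (intro absolutely_integrable_sum \<nu>_times_continuous_integrable[OF order_refl] continuous_intros
         x_continuous_complex trajectory_continuous[OF z]) auto
  then have "loewner_field n \<nu> x g z absolutely_integrable_on {0..T}"
    by (simp add: loewner_field_def[abs_def])
  then have "(\<lambda>s. inverse (g s z - complex_of_real (x k s)) *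
     (loewner_field n \<nu> x g z s - driving_field n m \<nu> \<xi>0 u0 x g k s)) absolutely_integrable_on {0..T}"
    using z_ne k
    by (intro absolutely_integrable_continuous_times set_integral_diff driving_field_integrable continuous_intros
         x_continuous_complex trajectory_continuous[OF z]) auto
  then show ?thesis
    by (simp add: gap_rate_def[abs_def] divide_inverse mult.commute)
qed

lemma gap_exp:
  assumes z: "trajectory T z" and k: "k \<in> {1..n}"
  shows "g T z - complex_of_real (x k T)
    = (z - complex_of_real (x k 0)) * exp (integral {0..T} (gap_rate m \<xi>0 u0 k z))"
proof -
  have "g T z - complex_of_real (x k T)
    = (g 0 z - complex_of_real (x k 0)) * exp (integral {0..T} (gap_rate m \<xi>0 u0 k z))"
  proof (rule linear_integral_equation_exp[OF T_nonneg gap_rate_integrable[OF z k]])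
    fix t assume t: "0 \<le> t" "t \<le> T"
    then have "((\<lambda>s. loewner_field n \<nu> x g z s - driving_field n m \<nu> \<xi>0 u0 x g k s) has_integral
         ((g t z - z) - (complex_of_real (x k t) - complex_of_real (x k 0)))) {0..t}"
      using z driving[OF k, of t] unfolding trajectory_def by (intro has_integral_diff) auto
    moreover have "loewner_field n \<nu> x g z s - driving_field n m \<nu> \<xi>0 u0 x g k s
        = (g s z - complex_of_real (x k s)) * gap_rate m \<xi>0 u0 k z s" if "s \<in> {0..t}" for s
      using trajectory_avoids[OF z _ k, of s] that t by (simp add: gap_rate_def)
    ultimately show "((\<lambda>s. (g s z - complex_of_real (x k s)) * gap_rate m \<xi>0 u0 k z s) has_integral
        g t z - complex_of_real (x k t) - (g 0 z - complex_of_real (x k 0))) {0..t}"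
      by (subst has_integral_cong[where g = "\<lambda>s. loewner_field n \<nu> x g z s - driving_field n m \<nu> \<xi>0 u0 x g k s"])
         (auto simp: g_0 algebra_simps)
  qed
  then show ?thesis by (simp add: g_0)
qed

text \<open>Pure algebra at one time. The gap rates sum to \<open>- pair_rate z z s\<close> minus
  the terms of the marked points. The coefficients in the driving equation are twice the exponents:
  4 corresponds to the square in the denominator, and \<open>4 * m - 2 * n - 4\<close> to the power
  of the factor with \<open>u\<close>.\<close>

lemma rates_balance:
  assumes z: "trajectory T z" and s: "s \<in> {0..T}"
  shows "pair_rate z z s + (\<Sum>k=1..n. gap_rate m \<xi>0 u0 k z s) - 2 * (\<Sum>l=1..m. pair_rate z (\<xi>0 l) s)
    + (case u0 of None \<Rightarrow> 0 | Some r \<Rightarrow> of_int (2 * int m - int n - 2) * pair_rate z (complex_of_real r) s) = 0"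
proof -
  define y where "y j = complex_of_real (x j s)" for j
  define v where "v j = complex_of_real (\<nu> j s)" for j
  define G where "G = g s z"
  define e :: complex where "e = of_int (2 * int m - int n - 2)"
  define R where "R k = (case u0 of None \<Rightarrow> 0 | Some r \<Rightarrow> 2 * e / (y k - g s (complex_of_real r)))
      - (\<Sum>l=1..m. 4 / (y k - g s (\<xi>0 l)))" for k
  have "(\<Sum>k=1..n. gap_rate m \<xi>0 u0 k z s) = (\<Sum>k=1..n. ((\<Sum>j=1..n. 2 * v j / (G - y j))
      - (v k * ((\<Sum>j\<in>{1..n}-{k}. 2 / (y k - y j)) + R k)
            + (\<Sum>j\<in>{1..n}-{k}. 2 * v j / (y k - y j)))) / (G - y k))"
    unfolding gap_rate_def loewner_field_def driving_field_def R_def y_def v_def G_def e_def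
    by (intro sum.cong refl) (simp add: algebra_simps split: option.split)
  also have "\<dots> = (\<Sum>k=1..n. 2 * v k / ((G - y k) * (G - y k))) - (\<Sum>k=1..n. v k * R k / (G - y k))"
  proof (rule sum_repulsion_cancel)
    show "G \<noteq> y k" if "k \<in> {1..n}" for k
      using trajectory_avoids[OF z s that] by (simp add: G_def y_def)
    show "inj_on y {1..n}"
      by (rule inj_onI) (auto simp: y_def dest: inj_onD[OF x_inj[OF s]])
  qed simp
  also have "(\<Sum>k=1..n. 2 * v k / ((G - y k) * (G - y k))) = - pair_rate z z s"
    by (simp add: pair_rate_def y_def v_def G_def)
  also have "(\<Sum>k=1..n. v k * R k / (G - y k)) =
      (case u0 of None \<Rightarrow> 0 | Some r \<Rightarrow> e * pair_rate z (complex_of_real r) s) - 2 * (\<Sum>l=1..m. pair_rate z (\<xi>0 l) s)"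
  proof -
    \<comment> \<open>Brings a term of a marked point with image \<open>w\<close> into the form of a
      summand of \<open>pair_rate\<close>.\<close>
    have flip: "v k * (c / (y k - w)) / (G - y k) = - (c * v k / ((G - y k) * (w - y k)))" for c k w
    proof -
      have "c / (y k - w) = - (c / (w - y k))" by (metis minus_diff_eq minus_divide_right)
      then show ?thesis by (simp add: mult_ac)
    qed
    have "(\<Sum>k=1..n. v k * (case u0 of None \<Rightarrow> 0 | Some r \<Rightarrow> 2 * e / (y k - g s (complex_of_real r))) / (G - y k))
        = (case u0 of None \<Rightarrow> 0 | Some r \<Rightarrow> e * pair_rate z (complex_of_real r) s)"
    proof (cases u0)
      case (Some r)
      have "(\<Sum>k=1..n. v k * (2 * e / (y k - g s (complex_of_real r))) / (G - y k))
          = e * pair_rate z (complex_of_real r) s"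
        unfolding flip pair_rate_def y_def[symmetric] v_def[symmetric] G_def[symmetric]
        by (simp add: sum_negf sum_distrib_left mult_ac)
      then show ?thesis by (simp add: Some)
    qed simp
    moreover have "(\<Sum>k=1..n. v k * (\<Sum>l=1..m. 4 / (y k - g s (\<xi>0 l))) / (G - y k))
        = 2 * (\<Sum>l=1..m. pair_rate z (\<xi>0 l) s)"
    proof -
      have "(\<Sum>k=1..n. v k * (\<Sum>l=1..m. 4 / (y k - g s (\<xi>0 l))) / (G - y k))
          = (\<Sum>l=1..m. \<Sum>k=1..n. v k * (4 / (y k - g s (\<xi>0 l))) / (G - y k))"
        unfolding sum_distrib_left sum_divide_distrib by (rule sum.swap)
      also have "\<dots> = (\<Sum>l=1..m. 2 * pair_rate z (\<xi>0 l) s)"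
        unfolding flip pair_rate_def y_def[symmetric] v_def[symmetric] G_def[symmetric]
        by (intro sum.cong refl) (simp add: sum_negf sum_distrib_left mult_ac)
      finally show ?thesis by (simp add: sum_distrib_left)
    qed
    ultimately show ?thesis
      by (simp add: R_def right_diff_distrib diff_divide_distrib sum_subtractf)
  qed
  finally show ?thesis unfolding e_def[symmetric] by simp
qed

text \<open>The exponential formulas for all factors are multiplied. Poles are not yet
  distinguished: under the convention for division by zero both sides are 0 there.\<close>

lemma motion_integral_conserved:
  assumes "0 \<le> Im z" and z: "trajectory T z"
  shows "(case u0 of None \<Rightarrow> 1 | Some r \<Rightarrow> (g T z - g T (complex_of_real r)) powi (2 * int m - int n - 2))
      * deriv (g T) z * (\<Prod>k=1..n. g T z - complex_of_real (x k T)) / (\<Prod>l=1..m. (g T z - g T (\<xi>0 l))\<^sup>2)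
    = (case u0 of None \<Rightarrow> 1 | Some r \<Rightarrow> (z - complex_of_real r) powi (2 * int m - int n - 2))
      * (\<Prod>k=1..n. z - complex_of_real (x k 0)) / (\<Prod>l=1..m. (z - \<xi>0 l)\<^sup>2)"
proof -
  define e where "e = 2 * int m - int n - 2"
  define P where "P w = integral {0..T} (pair_rate z w)" for w
  define Q where "Q k = integral {0..T} (gap_rate m \<xi>0 u0 k z)" for k
  define U where "U = (case u0 of None \<Rightarrow> 0 | Some r \<Rightarrow> of_int e * P (complex_of_real r))"
  have intP: "(pair_rate z w has_integral P w) {0..T}" if "trajectory T w" for w
    using pair_rate_integrable[OF order_refl z that] unfolding P_def
    by (auto simp: absolutely_integrable_on_def)
  have intQ: "(gap_rate m \<xi>0 u0 k z has_integral Q k) {0..T}" if "k \<in> {1..n}" for k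
    using gap_rate_integrable[OF z that] unfolding Q_def by (auto simp: absolutely_integrable_on_def)
  have intU: "((\<lambda>s. case u0 of None \<Rightarrow> 0 | Some r \<Rightarrow> of_int e * pair_rate z (complex_of_real r) s) has_integral U) {0..T}"
    unfolding U_def using intP u by (auto split: option.split intro: has_integral_mult_right)
  have "((\<lambda>s. pair_rate z z s + (\<Sum>k=1..n. gap_rate m \<xi>0 u0 k z s) - 2 * (\<Sum>l=1..m. pair_rate z (\<xi>0 l) s)
    + (case u0 of None \<Rightarrow> 0 | Some r \<Rightarrow> of_int e * pair_rate z (complex_of_real r) s)) has_integral
     P z + (\<Sum>k=1..n. Q k) - 2 * (\<Sum>l=1..m. P (\<xi>0 l)) + U) {0..T}"
    by (intro has_integral_add has_integral_diff has_integral_mult_right has_integral_sum intU intP z intQ \<xi>) auto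
  \<comment> \<open>The integrand is zero throughout \<open>{0..T}\<close>, so the pointwise balance
    becomes a relation between the exponents.\<close>
  from has_integral_unique[OF this has_integral_is_0[OF rates_balance[OF z, folded e_def]]]
  have "U + P z + (\<Sum>k=1..n. Q k) = 2 * (\<Sum>l=1..m. P (\<xi>0 l))"
    by (simp add: algebra_simps)
  then have balance: "exp U * exp (P z) * exp (\<Sum>k=1..n. Q k) = exp (2 * (\<Sum>l=1..m. P (\<xi>0 l)))"
    by (simp only: exp_add[symmetric])
  have diff: "g T z - g T w = (z - w) * exp (P w)" if "trajectory T w" for w
    unfolding P_def by (rule trajectory_difference[OF T_nonneg order_refl z that])
  have "deriv (g T) z = exp (P z)"
    unfolding P_def by (intro DERIV_imp_deriv flow_has_field_derivative assms)
  moreover have "(\<Prod>k=1..n. g T z - complex_of_real (x k T)) = (\<Prod>k=1..n. z - complex_of_real (x k 0)) * exp (\<Sum>k=1..n. Q k)"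
    using gap_exp[OF z] by (simp add: Q_def prod.distrib exp_sum)
  moreover have "(\<Prod>l=1..m. (g T z - g T (\<xi>0 l))\<^sup>2) = (\<Prod>l=1..m. (z - \<xi>0 l)\<^sup>2) * exp (2 * (\<Sum>l=1..m. P (\<xi>0 l)))"
    using diff[OF \<xi>] by (simp add: power_mult_distrib prod.distrib exp_sum sum_distrib_left flip: exp_double)
  moreover have "(case u0 of None \<Rightarrow> 1 | Some r \<Rightarrow> (g T z - g T (complex_of_real r)) powi e)
     = (case u0 of None \<Rightarrow> 1 | Some r \<Rightarrow> (z - complex_of_real r) powi e) * exp U"
    using diff[OF u] by (auto simp: U_def power_int_mult_distrib exp_power_int split: option.split)
  ultimately show ?thesis
    unfolding e_def[symmetric] balance[symmetric] by (simp add: divide_simps)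
qed

end

end

section \<open>From lifetimes and swallowing times to trajectories\<close>

lemma lifetime_no_collision:
  assumes "0 \<le> t" "ereal t < lifetime n m \<xi>0 u0 x g"
  shows "\<not> collision n m \<xi>0 u0 x g t"
proof
  assume "collision n m \<xi>0 u0 x g t"
  then have "lifetime n m \<xi>0 u0 x g \<le> ereal t"
    unfolding lifetime_def using assms(1) by (intro Inf_lower) auto
  then show False using assms(2) by simp
qed

lemma swallowing_time_no_hit:
  assumes "0 \<le> t" "ereal t < swallowing_time n x g z" "j \<in> {1..n}"
  shows "g t z \<noteq> complex_of_real (x j t)"
proof
  assume "g t z = complex_of_real (x j t)"
  then have "swallowing_time n x g z \<le> ereal t"
    unfolding swallowing_time_def using assms(1,3) by (intro Inf_lower) auto
  then show False using assms(2) by simp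
qed

text \<open>Serves the marked points, whose meeting with a driving point counts as a collision; they
  therefore survive up to the lifetime.\<close>

lemma lifetime_le_swallowing_time:
  assumes "\<And>t j. 0 \<le> t \<Longrightarrow> j \<in> {1..n} \<Longrightarrow> g t z = complex_of_real (x j t) \<Longrightarrow> collision n m \<xi>0 u0 x g t"
  shows "lifetime n m \<xi>0 u0 x g \<le> swallowing_time n x g z"
  unfolding lifetime_def swallowing_time_def using assms by (intro Inf_superset_mono) auto

text \<open>The flow is stopped at a fixed \<open>T\<close> before the lifetime, which gives a
  compact time interval without collisions.\<close>

locale chordal_flow =
  fixes n m :: nat and \<nu> x :: "nat \<Rightarrow> real \<Rightarrow> real" and x0 :: "nat \<Rightarrow> real" and \<xi>0 :: "nat \<Rightarrow> complex"
    and u0 :: "real option" and g :: "real \<Rightarrow> complex \<Rightarrow> complex" and T :: real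
  assumes flow: "multiple_chordal_loewner_flow n m \<nu> x0 \<xi>0 u0 x g"
    and conj_closed: "{#cnj (\<xi>0 l). l \<in># mset_set {1..m}#} = {#\<xi>0 l. l \<in># mset_set {1..m}#}"
    and T: "0 \<le> T" "ereal T < lifetime n m \<xi>0 u0 x g"
begin

lemma before_lifetime: "t \<le> T \<Longrightarrow> ereal t < lifetime n m \<xi>0 u0 x g"
  using T(2) by (meson ereal_less_eq(3) le_less_trans)

lemma flow_at_0: "g 0 z = z" "j \<in> {1..n} \<Longrightarrow> x j 0 = x0 j"
  using flow by (auto simp: multiple_chordal_loewner_flow_def Let_def)

lemma flow_driving:
  assumes "j \<in> {1..n}" "t \<in> {0..T}"
  shows "(driving_field n m \<nu> \<xi>0 u0 x g j has_integral complex_of_real (x j t) - complex_of_real (x j 0)) {0..t}"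
proof -
  have "(driving_field n m \<nu> \<xi>0 u0 x g j has_integral complex_of_real (x j t) - complex_of_real (x0 j)) {0..t}"
    using flow assms before_lifetime[of t] unfolding multiple_chordal_loewner_flow_def Let_def by auto
  then show ?thesis using flow_at_0(2)[OF assms(1)] by simp
qed

sublocale loewner_trajectories n \<nu> x g T
proof
  fix j assume j: "j \<in> {1..n}"
  show "\<nu> j absolutely_integrable_on {0..T}"
    using flow T j unfolding multiple_chordal_loewner_flow_def Let_def by blast
  let ?F = "driving_field n m \<nu> \<xi>0 u0 x g j"
  have int: "?F integrable_on {0..T}" using flow_driving[OF j, of T] T by auto
  have eq: "x j t = Re (complex_of_real (x j 0) + integral {0..t} ?F)" if "t \<in> {0..T}" for t
    using integral_unique[OF flow_driving[OF j that]] by simp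
  show "continuous_on {0..T} (x j)"
    by (subst continuous_on_cong[OF refl eq])
       (auto intro!: continuous_intros indefinite_integral_continuous_1 int)
qed (use T flow_at_0 in auto)

lemma trajectoryI:
  assumes "0 \<le> Im w" "S \<le> T" "ereal S < swallowing_time n x g w"
  shows "trajectory S w"
  unfolding trajectory_def
proof (intro conjI ballI)
  fix t assume t: "t \<in> {0..S}"
  then have less: "ereal t < swallowing_time n x g w"
    using assms(3) by (auto intro: le_less_trans[of _ "ereal S"])
  then have "ereal t < min (swallowing_time n x g w) (lifetime n m \<xi>0 u0 x g)"
    using before_lifetime[of t] t assms(2) by auto
  then show "(loewner_field n \<nu> x g w has_integral g t w - w) {0..t}"
    using flow assms(1) t unfolding multiple_chordal_loewner_flow_def Let_def by auto
  show "g t w \<noteq> complex_of_real (x j t)" if "j \<in> {1..n}" for j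
    using swallowing_time_no_hit[OF _ less that] t by auto
qed

sublocale loewner_flow_segment n \<nu> x g T
proof
  show "g t (cnj z) = cnj (g t z)" if "t \<in> {0..T}" for t z
    using flow that before_lifetime[of t] unfolding multiple_chordal_loewner_flow_def Let_def by auto
  fix w :: complex assume w: "0 \<le> Im w"
  show "trajectory T w \<or> (\<exists>S\<in>{0..T}. continuous_on {0..S} (\<lambda>s. g s w) \<and> (\<forall>s\<in>{0..<S}. trajectory s w) \<and>
         (\<exists>j\<in>{1..n}. g S w = complex_of_real (x j S)))"
  proof (cases "ereal T < swallowing_time n x g w")
    case True
    then show ?thesis using trajectoryI[OF w] by simp
  next
    case False
    have "0 \<le> swallowing_time n x g w"
      unfolding swallowing_time_def by (rule Inf_greatest) auto
    \<comment> \<open>A point swallowed by time \<open>T\<close> has a real swallowing time before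
      the lifetime, so the last clause of the flow definition provides the hit and continuity up to
      it.\<close>
    with False obtain S where S: "swallowing_time n x g w = ereal S" "0 \<le> S" "S \<le> T"
      by (cases "swallowing_time n x g w") auto
    have "(\<exists>j\<in>{1..n}. g S w = complex_of_real (x j S)) \<and> continuous_on {0..S} (\<lambda>s. g s w)"
      using flow w S before_lifetime[OF S(3)] unfolding multiple_chordal_loewner_flow_def Let_def by auto
    moreover have "trajectory s w" if "s \<in> {0..<S}" for s
      using that S by (intro trajectoryI[OF w]) auto
    ultimately show ?thesis using S by auto
  qed
qed

text \<open>The Loewner equation is given only in the closed upper half-plane. A marked point below
  it is the conjugate of another marked point above.\<close>

lemma \<xi>_trajectory:
  assumes l: "l \<in> {1..m}"
  shows "trajectory T (\<xi>0 l)"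
proof -
  have upper: "trajectory T (\<xi>0 k)" if "k \<in> {1..m}" "0 \<le> Im (\<xi>0 k)" for k
  proof (rule trajectoryI[OF that(2) order_refl])
    have "lifetime n m \<xi>0 u0 x g \<le> swallowing_time n x g (\<xi>0 k)"
      using that(1) by (intro lifetime_le_swallowing_time) (metis collision_def)
    then show "ereal T < swallowing_time n x g (\<xi>0 k)" using T(2) by (rule less_le_trans[rotated])
  qed
  show ?thesis
  proof (cases "0 \<le> Im (\<xi>0 l)")
    case False
    have "(\<lambda>l. cnj (\<xi>0 l)) ` {1..m} = \<xi>0 ` {1..m}"
      using arg_cong[OF conj_closed, of set_mset] by simp
    then obtain k where k: "k \<in> {1..m}" "\<xi>0 k = cnj (\<xi>0 l)" using l by (metis imageE imageI)
    then show ?thesis using upper[OF k(1)] False trajectory_cnj[of T "\<xi>0 k"] by simp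
  qed (use upper l in auto)
qed

lemma u_trajectory:
  assumes "u0 = Some r"
  shows "trajectory T (complex_of_real r)"
proof (rule trajectoryI)
  have "lifetime n m \<xi>0 u0 x g \<le> swallowing_time n x g (complex_of_real r)"
    using assms by (intro lifetime_le_swallowing_time) (metis collision_def)
  then show "ereal T < swallowing_time n x g (complex_of_real r)" using T(2) by (rule less_le_trans[rotated])
qed auto

lemma x_distinct:
  assumes "s \<in> {0..T}"
  shows "inj_on (\<lambda>j. x j s) {1..n}"
  using lifetime_no_collision[OF _ before_lifetime, of s] assms
  unfolding collision_def inj_on_def by (metis atLeastAtMost_iff)

lemma conservation:
  assumes "0 \<le> Im z" and z: "trajectory T z"
  shows "(case u0 of None \<Rightarrow> 1 | Some r \<Rightarrow> (g T z - g T (complex_of_real r)) powi (2 * int m - int n - 2))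
      * deriv (g T) z * (\<Prod>k=1..n. g T z - complex_of_real (x k T)) / (\<Prod>l=1..m. (g T z - g T (\<xi>0 l))\<^sup>2)
    = (case u0 of None \<Rightarrow> 1 | Some r \<Rightarrow> (z - complex_of_real r) powi (2 * int m - int n - 2))
      * (\<Prod>k=1..n. z - complex_of_real (x k 0)) / (\<Prod>l=1..m. (z - \<xi>0 l)\<^sup>2)"
  by (rule motion_integral_conserved[OF \<xi>_trajectory u_trajectory x_distinct flow_driving assms])

text \<open>Settles the \<open>Infinity\<close> branches: the image of \<open>z\<close> meets that
  of a marked point at time \<open>T\<close> exactly if the two coincide at time 0.\<close>

lemma trajectories_eq_iff:
  assumes "trajectory T z" "trajectory T w"
  shows "g T z = g T w \<longleftrightarrow> z = w"
  using trajectory_difference[OF T_nonneg order_refl assms] by auto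

lemma deriv_g_0: "deriv (g 0) z = 1"
proof -
  have "g 0 = (\<lambda>z. z)" by (simp add: flow_at_0 fun_eq_iff)
  then show ?thesis by simp
qed

lemma motion_integral_finite_conserved:
  assumes "u0 = Some r" "0 \<le> Im z" "trajectory T z"
  shows "motion_integral_finite n m \<xi>0 r x g T z = motion_integral_finite n m \<xi>0 r x g 0 z"
  using conservation[OF assms(2,3)] trajectories_eq_iff[OF assms(3) \<xi>_trajectory]
    trajectories_eq_iff[OF assms(3) u_trajectory[OF assms(1)]]
  by (auto simp: motion_integral_finite_def Let_def flow_at_0(1) deriv_g_0 assms(1))

lemma motion_integral_infinity_conserved:
  assumes "u0 = None" "0 \<le> Im z" "trajectory T z"
  shows "motion_integral_infinity n m \<xi>0 x g T z = motion_integral_infinity n m \<xi>0 x g 0 z"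
  using conservation[OF assms(2,3)] trajectories_eq_iff[OF assms(3) \<xi>_trajectory]
  by (auto simp: motion_integral_infinity_def flow_at_0(1) deriv_g_0 assms(1))

end

theorem theorem1p6:
  fixes n m :: nat
    and \<nu> :: "nat \<Rightarrow> real \<Rightarrow> real"
    and x0 :: "nat \<Rightarrow> real"
    and \<xi>0 :: "nat \<Rightarrow> complex"
    and x :: "nat \<Rightarrow> real \<Rightarrow> real"
    and g :: "real \<Rightarrow> complex \<Rightarrow> complex"
  assumes "n \<ge> 1" and "m \<ge> 1"
    and "\<And>j. j \<in> {1..n} \<Longrightarrow> \<nu> j \<in> borel_measurable (lebesgue_on {0..})"
    and "\<And>j t. j \<in> {1..n} \<Longrightarrow> 0 \<le> t \<Longrightarrow> 0 \<le> \<nu> j t"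
    and "inj_on x0 {1..n}"
    and "{#cnj (\<xi>0 l). l \<in># mset_set {1..m}#} = {#\<xi>0 l. l \<in># mset_set {1..m}#}"
    and "\<And>j l. j \<in> {1..n} \<Longrightarrow> l \<in> {1..m} \<Longrightarrow> \<xi>0 l \<noteq> complex_of_real (x0 j)"
  shows "(\<forall>r. r \<notin> x0 ` {1..n} \<and> complex_of_real r \<notin> \<xi>0 ` {1..m} \<and>
              multiple_chordal_loewner_flow n m \<nu> x0 \<xi>0 (Some r) x g \<longrightarrow>
            (\<forall>z t. 0 \<le> Im z \<and> 0 \<le> t \<and>
                   ereal t < min (swallowing_time n x g z) (lifetime n m \<xi>0 (Some r) x g) \<longrightarrow>
                 motion_integral_finite n m \<xi>0 r x g t z
                   = motion_integral_finite n m \<xi>0 r x g 0 z)) \<and>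
         (multiple_chordal_loewner_flow n m \<nu> x0 \<xi>0 None x g \<longrightarrow>
            (\<forall>z t. 0 \<le> Im z \<and> 0 \<le> t \<and>
                   ereal t < min (swallowing_time n x g z) (lifetime n m \<xi>0 None x g) \<longrightarrow>
                 motion_integral_infinity n m \<xi>0 x g t z
                   = motion_integral_infinity n m \<xi>0 x g 0 z))"
proof (intro conjI impI allI)
  fix r z t
  assume "r \<notin> x0 ` {1..n} \<and> complex_of_real r \<notin> \<xi>0 ` {1..m} \<and>
      multiple_chordal_loewner_flow n m \<nu> x0 \<xi>0 (Some r) x g"
    and z: "0 \<le> Im z \<and> 0 \<le> t \<and>
      ereal t < min (swallowing_time n x g z) (lifetime n m \<xi>0 (Some r) x g)"
  \<comment> \<open>The segment ends at the time \<open>t\<close> in question. Being below the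
    minimum, \<open>t\<close> precedes the lifetime, as the locale requires, and also the swallowing
    time, so that \<open>z\<close> is a trajectory up to \<open>t\<close>.\<close>
  then interpret chordal_flow n m \<nu> x x0 \<xi>0 "Some r" g t
    using assms(6) by unfold_locales auto
  show "motion_integral_finite n m \<xi>0 r x g t z = motion_integral_finite n m \<xi>0 r x g 0 z"
    using z by (intro motion_integral_finite_conserved trajectoryI) auto
next
  fix z t
  assume "multiple_chordal_loewner_flow n m \<nu> x0 \<xi>0 None x g"
    and z: "0 \<le> Im z \<and> 0 \<le> t \<and>
      ereal t < min (swallowing_time n x g z) (lifetime n m \<xi>0 None x g)"
  then interpret chordal_flow n m \<nu> x x0 \<xi>0 None g t
    using assms(6) by unfold_locales auto
  show "motion_integral_infinity n m \<xi>0 x g t z = motion_integral_infinity n m \<xi>0 x g 0 z"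
    using z by (intro motion_integral_infinity_conserved trajectoryI) auto
qed

end
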